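(* For any given $\mathbf{x}\in\mathbb{R}^n$, it holds that $$\|\mathbf{x}\|_0=\min_{-\mathbf{1}\le\mathbf{u}\le\mathbf{1}}~\|\mathbf{u}\|_1\quad\text{s.t.}\quad\|\mathbf{x}\|_1=\langle\mathbf{u},\mathbf{x}\rangle,$$ where the minimum is over $\mathbf{u}\in\mathbb{R}^n$, and $\mathbf{u}^*=\operatorname{sign}(\mathbf{x})$ is the unique optimal solution of this minimization problem.
   Context: $\|\mathbf{x}\|_0$ is the number of nonzero entries of $\mathbf{x}$. The signum function is applied componentwise, with $\operatorname{sign}(0)=0$. Vector inequalities are componentwise and $\mathbf{1}$ is the all-ones vector. *)

theory Defs
  imports "HOL-Analysis.Analysis"
begin

definition l0_norm :: "real ^ 'n \<Rightarrow> nat"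
  where "l0_norm x = card {i. x $ i \<noteq> 0}"

definition l1_norm :: "real ^ 'n \<Rightarrow> real"
  where "l1_norm x = (\<Sum>i\<in>UNIV. \<bar>x $ i\<bar>)"

(* The library's sgn on real ^ 'n is the normalisation x scaled by 1 / norm x,
   so the componentwise sign needs its own definition. *)
definition sign_vec :: "real ^ 'n \<Rightarrow> real ^ 'n"
  where "sign_vec x = (\<chi> i. sgn (x $ i))"

(* On real ^ 'n the order is componentwise and 1 is the all-ones vector. *)
definition feasible :: "real ^ 'n \<Rightarrow> (real ^ 'n) set"
  where "feasible x = {u. - 1 \<le> u \<and> u \<le> 1 \<and> l1_norm x = u \<bullet> x}"

(* The minimum is attained. The library's Min is not usable here: it is only
   meaningful on finite sets. *)
definition is_min_value :: "('a \<Rightarrow> real) \<Rightarrow> 'a set \<Rightarrow> real \<Rightarrow> bool"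
  where "is_min_value f S m \<longleftrightarrow> m \<in> f ` S \<and> (\<forall>u\<in>S. m \<le> f u)"

end

theory Submission
  imports Defs
begin

text \<open>For \<open>- 1 \<le> u \<le> 1\<close> each term satisfies \<open>u\<^sub>i x\<^sub>i \<le> \<bar>x\<^sub>i\<bar>\<close>, so equality of the sums forces
  equality in every term, that is, \<open>u\<^sub>i = sgn x\<^sub>i\<close> wherever \<open>x\<^sub>i \<noteq> 0\<close>. The remaining entries of
  \<open>u\<close> are free, and the \<open>\<ell>\<^sub>1\<close> norm is minimal precisely when they all vanish.\<close>

lemma mult_eq_abs_iff_sgn:
  fixes a b :: real
  assumes "b \<noteq> 0"
  shows "a * b = \<bar>b\<bar> \<longleftrightarrow> a = sgn b"
  using assms by (metis abs_sgn mult.commute mult_right_cancel)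

text \<open>Decouples the single scalar constraint into coordinates, so that norms can later be
  compared entry by entry.\<close>

lemma feasible_iff:
  fixes x u :: "real ^ 'n"
  shows "u \<in> feasible x \<longleftrightarrow>
    (\<forall>i. \<bar>u $ i\<bar> \<le> 1) \<and> (\<forall>i. x $ i \<noteq> 0 \<longrightarrow> u $ i = sgn (x $ i))"
proof -
  have box: "- 1 \<le> u \<and> u \<le> 1 \<longleftrightarrow> (\<forall>i. \<bar>u $ i\<bar> \<le> 1)"
    by (auto simp: less_eq_vec_def abs_le_iff minus_le_iff)
  have "l1_norm x = u \<bullet> x \<longleftrightarrow> (\<forall>i. x $ i \<noteq> 0 \<longrightarrow> u $ i = sgn (x $ i))"
    if bound: "\<forall>i. \<bar>u $ i\<bar> \<le> 1"
  proof -
    have nonneg: "0 \<le> \<bar>x $ i\<bar> - u $ i * x $ i" for i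
    proof -
      have "u $ i * x $ i \<le> \<bar>u $ i\<bar> * \<bar>x $ i\<bar>"
        by (simp flip: abs_mult)
      also have "\<dots> \<le> \<bar>x $ i\<bar>"
        using bound by (simp add: mult_left_le_one_le)
      finally show ?thesis by simp
    qed
    have "l1_norm x = u \<bullet> x \<longleftrightarrow> (\<Sum>i\<in>UNIV. \<bar>x $ i\<bar> - u $ i * x $ i) = 0"
      by (simp add: l1_norm_def inner_vec_def sum_subtractf)
    also have "\<dots> \<longleftrightarrow> (\<forall>i. u $ i * x $ i = \<bar>x $ i\<bar>)"
      using nonneg by (subst sum_nonneg_eq_0_iff) auto
    \<comment> \<open>Where \<open>x $ i = 0\<close> the equation reads \<open>0 = 0\<close> and
      leaves \<open>u $ i\<close> free.\<close>
    also have "\<dots> \<longleftrightarrow> (\<forall>i. x $ i \<noteq> 0 \<longrightarrow> u $ i = sgn (x $ i))"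
      by (metis mult_eq_abs_iff_sgn abs_zero mult_zero_right)
    finally show ?thesis .
  qed
  with box show ?thesis
    by (auto simp: feasible_def)
qed

lemma sign_vec_feasible: "sign_vec x \<in> feasible x"
  by (simp add: feasible_iff sign_vec_def abs_sgn_eq)

text \<open>Each \<open>\<bar>sgn (x $ i)\<bar>\<close> is the 0-1 indicator of
  \<open>x $ i \<noteq> 0\<close>, so the sum counts the support.\<close>

lemma l1_norm_sign_vec: "l1_norm (sign_vec x) = real (l0_norm x)"
  by (simp add: l1_norm_def l0_norm_def sign_vec_def abs_sgn_eq sum.If_cases Collect_neg_eq)

lemma abs_sign_vec_le:
  assumes "u \<in> feasible x"
  shows "\<bar>sign_vec x $ i\<bar> \<le> \<bar>u $ i\<bar>"
  using assms by (cases "x $ i = 0") (auto simp: feasible_iff sign_vec_def)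

lemma l1_norm_sign_vec_le:
  assumes "u \<in> feasible x"
  shows "l1_norm (sign_vec x) \<le> l1_norm u"
  unfolding l1_norm_def by (intro sum_mono abs_sign_vec_le assms)

lemma l1_norm_le_sign_vec_imp_eq:
  assumes u: "u \<in> feasible x" and le: "l1_norm u \<le> l1_norm (sign_vec x)"
  shows "u = sign_vec x"
proof -
  have "l1_norm (sign_vec x) = l1_norm u"
    using l1_norm_sign_vec_le[OF u] le by simp
  \<comment> \<open>Equal sums under termwise domination force equal terms.\<close>
  then have abs_eq: "\<bar>sign_vec x $ i\<bar> = \<bar>u $ i\<bar>" for i
    unfolding l1_norm_def by (rule sum_mono_inv) (auto intro: abs_sign_vec_le[OF u])
  \<comment> \<open>Off the support of \<open>x\<close> both absolute values are 0; on it
    feasibility already fixes \<open>u $ i\<close>.\<close>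
  have "u $ i = sign_vec x $ i" for i
    using abs_eq[of i] u by (cases "x $ i = 0") (auto simp: feasible_iff sign_vec_def)
  then show ?thesis
    by (simp add: vec_eq_iff)
qed

theorem lemma1:
  fixes x :: "real ^ 'n"
  shows "is_min_value l1_norm (feasible x) (real (l0_norm x)) \<and>
    (\<forall>u. is_arg_min l1_norm (\<lambda>v. v \<in> feasible x) u \<longleftrightarrow> u = sign_vec x)"
proof
  show "is_min_value l1_norm (feasible x) (real (l0_norm x))"
    unfolding is_min_value_def l1_norm_sign_vec[symmetric]
    using sign_vec_feasible l1_norm_sign_vec_le by blast
  \<comment> \<open>For uniqueness, a minimizer is compared with the feasible point
    \<open>sign_vec x\<close>.\<close>
  show "\<forall>u. is_arg_min l1_norm (\<lambda>v. v \<in> feasible x) u \<longleftrightarrow> u = sign_vec x"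
    unfolding is_arg_min_linorder
    using sign_vec_feasible l1_norm_sign_vec_le l1_norm_le_sign_vec_imp_eq by blast
qed

end
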